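(* Let $X=\{P_1,\dots,P_r\}$ be a set of $r$ distinct points of $\mathbb P^n_{\mathbf k}$, not contained in a hyperplane, of socle degree $s$, and let $L_1,\dots,L_r$ be the associated linear forms. Given an integer $u\ge1$ and $\alpha_1,\dots,\alpha_r\in\mathbf k^*$, consider the family of polynomials $F_j=\frac1{(j+u)!}\sum_{i=1}^r\alpha_iL_i^{j+u}$, $j\ge1$. Then for all integers $w\ge1$, all $i=1,\dots,r$ and all $t\ge\max\{s,\,s+w-u\}$ there exists a homogeneous form $\beta_i\in R$ of degree $t+u-w$ such that $$L_i^w=\beta_i\circ F_t.$$
   Context: $\mathbf k$ is an algebraically closed field of characteristic zero, $n\ge1$, $R=\mathbf k[x_0,\dots,x_n]$ (standard graded) and $\Gamma=\mathbf k[y_0,\dots,y_n]$. $R$ acts on $\Gamma$ by differentiation: $f\circ g=f(\partial_{y_0},\dots,\partial_{y_n})(g)$. $I(X)\subset R$ is the homogeneous ideal of $X$. With $\mathrm{HF}_X(t)=\dim_{\mathbf k}(R/I(X))_t$, the socle degree $s$ of $X$ is the largest $t$ with $\mathrm{HF}_X(t)-\mathrm{HF}_X(t-1)\ne0$, equivalently the least $t$ with $\mathrm{HF}_X(t)=r$. The linear form associated to $P=[a_0,\dots,a_n]$ is $L=a_0y_0+\cdots+a_ny_n\in\Gamma$ (for a fixed choice of homogeneous coordinates). *)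

theory Defs
  imports
    "HOL-Analysis.Finite_Cartesian_Product"
    "HOL-Library.Poly_Mapping"
    "HOL-Computational_Algebra.Polynomial"
begin

text \<open>
  The polynomial ring in the variables indexed by the finite type \<open>'v\<close>, as the monoid algebra of
  the exponent vectors. With \<open>CARD('v) = n + 1\<close>, the same type serves for
  \<open>R = k[x\<^sub>0, \<dots>, x\<^sub>n]\<close> and for \<open>\<Gamma> = k[y\<^sub>0, \<dots>, y\<^sub>n]\<close>.
\<close>

type_synonym ('v, 'k) mpoly = "('v \<Rightarrow>\<^sub>0 nat) \<Rightarrow>\<^sub>0 'k"

definition const :: "'k \<Rightarrow> ('v, 'k::zero) mpoly" where
  "const c = Poly_Mapping.single 0 c"

definition var :: "'v \<Rightarrow> ('v, 'k::zero_neq_one) mpoly" where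
  "var v = Poly_Mapping.single (Poly_Mapping.single v 1) 1"

definition mdeg :: "('v::finite \<Rightarrow>\<^sub>0 nat) \<Rightarrow> nat" where
  "mdeg m = (\<Sum>v\<in>UNIV. Poly_Mapping.lookup m v)"

text \<open>The zero polynomial is homogeneous of every degree.\<close>

definition homogeneous :: "nat \<Rightarrow> ('v::finite, 'k::zero) mpoly \<Rightarrow> bool" where
  "homogeneous d f \<longleftrightarrow> (\<forall>m\<in>Poly_Mapping.keys f. mdeg m = d)"

definition eval_at :: "'k^'v \<Rightarrow> ('v::finite, 'k::comm_semiring_1) mpoly \<Rightarrow> 'k" where
  "eval_at a f = (\<Sum>m\<in>Poly_Mapping.keys f. Poly_Mapping.lookup f m *
     (\<Prod>v\<in>UNIV. (a $ v) ^ Poly_Mapping.lookup m v))"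

definition linear_form :: "'k^'v \<Rightarrow> ('v::finite, 'k::comm_semiring_1) mpoly" where
  "linear_form a = (\<Sum>v\<in>UNIV. const (a $ v) * var v)"


subsection \<open>The action by differentiation\<close>

definition partial_deriv :: "'v \<Rightarrow> ('v, 'k::comm_semiring_1) mpoly \<Rightarrow> ('v, 'k) mpoly" where
  "partial_deriv v g = (\<Sum>m\<in>Poly_Mapping.keys g.
     Poly_Mapping.single (m - Poly_Mapping.single v 1)
       (of_nat (Poly_Mapping.lookup m v) * Poly_Mapping.lookup g m))"

text \<open>
  The composite, over all variables \<open>v\<close>, of the \<open>m\<^sub>v\<close>-fold iterates of \<open>partial_deriv v\<close>. The fold
  does not depend on the order, since partial derivatives commute
  (\<open>partial_deriv_pow_comp_fun_commute\<close> below).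
\<close>

definition monom_deriv ::
    "('v::finite \<Rightarrow>\<^sub>0 nat) \<Rightarrow> ('v, 'k::comm_semiring_1) mpoly \<Rightarrow> ('v, 'k) mpoly" where
  "monom_deriv m g = Finite_Set.fold (\<lambda>v. partial_deriv v ^^ Poly_Mapping.lookup m v) g UNIV"

definition diff_action ::
    "('v::finite, 'k::comm_semiring_1) mpoly \<Rightarrow> ('v, 'k) mpoly \<Rightarrow> ('v, 'k) mpoly" where
  "diff_action f g =
     (\<Sum>m\<in>Poly_Mapping.keys f. const (Poly_Mapping.lookup f m) * monom_deriv m g)"

lemma lookup_partial_deriv:
  "Poly_Mapping.lookup (partial_deriv v g) q =
     of_nat (Poly_Mapping.lookup q v + 1) *
       Poly_Mapping.lookup g (q + Poly_Mapping.single v 1)"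
proof -
  let ?e = "Poly_Mapping.single v (1::nat)"
  let ?q = "q + ?e"
  have eq: "Poly_Mapping.lookup (Poly_Mapping.single (m - ?e)
        (of_nat (Poly_Mapping.lookup m v) * Poly_Mapping.lookup g m)) q =
      (if m = ?q then of_nat (Poly_Mapping.lookup ?q v) * Poly_Mapping.lookup g ?q else 0)"
    (is "?l m = _") for m
  proof (cases "Poly_Mapping.lookup m v = 0")
    case True
    then have "m \<noteq> ?q" by (auto simp: lookup_add)
    with True show ?thesis by simp
  next
    case False
    then have "m = (m - ?e) + ?e"
      by (intro poly_mapping_eqI) (auto simp: lookup_add lookup_minus lookup_single when_def)
    then have "m - ?e = q \<longleftrightarrow> m = ?q" by (metis add_right_cancel)
    then show ?thesis by (auto simp: lookup_single when_def)
  qed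
  have "Poly_Mapping.lookup (partial_deriv v g) q = (\<Sum>m\<in>Poly_Mapping.keys g. ?l m)"
    by (simp only: partial_deriv_def lookup_sum)
  also have "\<dots> = of_nat (Poly_Mapping.lookup ?q v) * Poly_Mapping.lookup g ?q"
    unfolding eq by (auto simp: sum.delta in_keys_iff)
  finally show ?thesis by (simp add: lookup_add)
qed

lemma partial_deriv_commute:
  "partial_deriv v (partial_deriv w g) = partial_deriv w (partial_deriv v g)"
  by (cases "v = w")
    (auto intro!: poly_mapping_eqI
      simp: lookup_partial_deriv lookup_add lookup_single ac_simps)

lemma partial_deriv_pow_comp_fun_commute:
  "comp_fun_commute (\<lambda>v. partial_deriv v ^^ k v)"
proof
  fix v w :: 'a
  have 1: "partial_deriv w ((partial_deriv v ^^ i) g) = (partial_deriv v ^^ i) (partial_deriv w g)"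
    for i and g :: "('a, 'b) mpoly"
    by (induction i) (simp_all add: partial_deriv_commute)
  have "(partial_deriv w ^^ j) ((partial_deriv v ^^ i) g) =
      (partial_deriv v ^^ i) ((partial_deriv w ^^ j) g)" for i j and g :: "('a, 'b) mpoly"
    by (induction j) (simp_all add: 1)
  then show "(partial_deriv w ^^ k w) \<circ> (partial_deriv v ^^ k v) =
      (partial_deriv v ^^ k v) \<circ> (partial_deriv w ^^ k w :: ('a, 'b) mpoly \<Rightarrow> _)"
    by (simp add: fun_eq_iff)
qed


subsection \<open>Projective space and Hilbert functions\<close>

text \<open>A point is the set of all its homogeneous coordinate vectors.\<close>

definition proportional :: "(('k::field^'v::finite) \<times> ('k^'v)) set" where
  "proportional = {(a, b). a \<noteq> 0 \<and> (\<exists>c. c \<noteq> 0 \<and> b = c *s a)}"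

definition proj_space :: "('k::field^'v::finite) set set" where
  "proj_space = (UNIV - {0}) // proportional"

definition hyperplane :: "('k::field^'v::finite) set set \<Rightarrow> bool" where
  "hyperplane H \<longleftrightarrow>
     (\<exists>c. c \<noteq> 0 \<and> H = {p \<in> proj_space. \<forall>a\<in>p. (\<Sum>v\<in>UNIV. c $ v * a $ v) = 0})"

lemma module_mult: "module ((*) :: 'a::comm_ring_1 \<Rightarrow> 'a \<Rightarrow> 'a)"
  by unfold_locales (simp_all add: algebra_simps)

text \<open>The ideal generated by the forms vanishing on \<open>X\<close>; \<open>module.span (*)\<close> is the ideal span.\<close>

definition ideal_of :: "('k::field^'v::finite) set set \<Rightarrow> ('v, 'k) mpoly set" where
  "ideal_of X = module.span (*)
     {f. (\<exists>d. homogeneous d f) \<and> (\<forall>p\<in>X. \<forall>a\<in>p. eval_at a f = 0)}"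

text \<open>
  \<open>B\<close> is a finite set of degree-\<open>t\<close> forms whose residue classes are pairwise distinct and form a
  basis of the degree-\<open>t\<close> part of the quotient by the homogeneous ideal \<open>I\<close>.
\<close>

definition quotient_basis ::
    "('v::finite, 'k::field) mpoly set \<Rightarrow> nat \<Rightarrow> ('v, 'k) mpoly set \<Rightarrow> bool" where
  "quotient_basis I t B \<longleftrightarrow>
     finite B \<and> (\<forall>b\<in>B. homogeneous t b) \<and>
     (\<forall>c. (\<Sum>b\<in>B. const (c b) * b) \<in> I \<longrightarrow> (\<forall>b\<in>B. c b = 0)) \<and>
     (\<forall>f. homogeneous t f \<longrightarrow> (\<exists>c. f - (\<Sum>b\<in>B. const (c b) * b) \<in> I))"

definition hilbert_fun :: "('k::field^'v::finite) set set \<Rightarrow> nat \<Rightarrow> nat" where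
  "hilbert_fun X t = card (SOME B. quotient_basis (ideal_of X) t B)"

text \<open>The convention is that the Hilbert function vanishes in degree \<open>-1\<close>.\<close>

definition hilbert_diff :: "('k::field^'v::finite) set set \<Rightarrow> nat \<Rightarrow> int" where
  "hilbert_diff X t =
     int (hilbert_fun X t) - (if t = 0 then 0 else int (hilbert_fun X (t - 1)))"

definition socle_degree :: "('k::field^'v::finite) set set \<Rightarrow> nat" where
  "socle_degree X = (GREATEST t. hilbert_diff X t \<noteq> 0)"

end

theory Submission
  imports Defs "HOL-Library.Function_Algebras"
begin

text \<open>
  A form \<open>\<beta>\<close> of degree \<open>t + u - w\<close> acts on a power of the linear form of a point \<open>a\<close> through its value
  there: \<open>\<beta> \<circ> L\<^sup>t\<^sup>+\<^sup>u = (t + u)!/w! \<cdot> \<beta>(a) \<cdot> L\<^sup>w\<close>. So it suffices to find a \<open>\<beta>\<close> which vanishes at all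
  points but \<open>P\<^sub>i\<close> and takes the value \<open>w!/\<alpha>\<^sub>i\<close> there. The Hilbert function in degree \<open>d\<close> is the rank of
  the map sending a form of degree \<open>d\<close> to its values at the \<open>r\<close> points. Products of linear forms show
  that this rank is \<open>r\<close> for large \<open>d\<close>, and it is constant from the socle degree on, so interpolation
  is possible in every degree \<open>\<ge> s\<close>. The hyperplane hypothesis forces \<open>s \<ge> 1\<close>, hence \<open>t \<ge> 1\<close>, which
  is needed because \<open>F\<^sub>0\<close> is unconstrained.
\<close>

subsection \<open>Polynomials: evaluation, homogeneity, differentiation\<close>

text \<open>A polynomial is the finite sum of its terms, so identities additive in each factor, such
  as the multiplicativity of evaluation and the Leibniz rule, reduce to single terms.\<close>

lemma mpoly_add_single_induct [case_names zero single add]: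
  fixes f :: "('v, 'k::comm_monoid_add) mpoly"
  assumes "Q 0" "\<And>m c. Q (Poly_Mapping.single m c)"
    and "\<And>f g. Q f \<Longrightarrow> Q g \<Longrightarrow> Q (f + g)"
  shows "Q f"
proof -
  have eq: "f = (\<Sum>m\<in>Poly_Mapping.keys f. Poly_Mapping.single m (Poly_Mapping.lookup f m))"
    by (rule poly_mapping_eqI)
      (auto simp: lookup_sum lookup_single when_def in_keys_iff sum.delta)
  have "Q (\<Sum>m\<in>A. Poly_Mapping.single m (h m))" if "finite A" for A and h :: "_ \<Rightarrow> 'k"
    using that by induction (auto intro: assms)
  then show ?thesis by (subst eq) simp
qed

section \<open>Constants and evaluation at a vector\<close>

lemma const_mult: "const (c * d) = (const c * const d :: ('v, 'k::comm_semiring_1) mpoly)"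
  by (simp add: const_def mult_single)

lemma const_one [simp]: "const 1 = (1 :: ('v, 'k::comm_semiring_1) mpoly)"
  by (simp add: const_def)

lemma const_zero [simp]: "const 0 = (0 :: ('v, 'k::comm_semiring_1) mpoly)"
  by (simp add: const_def)

lemma const_sum: "const (sum f A) = (\<Sum>x\<in>A. const (f x) :: ('v, 'k::comm_semiring_1) mpoly)"
  by (induction A rule: infinite_finite_induct) (auto simp: const_def single_add)

lemma lookup_const_mult:
  "Poly_Mapping.lookup (const c * f :: ('v, 'k::comm_semiring_1) mpoly) m =
     c * Poly_Mapping.lookup f m"
proof -
  have "const c * f = Poly_Mapping.map ((*) c) f"
    by (simp add: const_def mult_map_scale_conv_mult)
  then show ?thesis
    by (simp add: Poly_Mapping.map.rep_eq when_def)
qed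

text \<open>Cancellation can shrink the support of a sum; a common finite index set makes the sums
  for \<open>f\<close>, \<open>g\<close> and \<open>f + g\<close> comparable.\<close>

lemma eval_at_superset:
  assumes "finite A" "Poly_Mapping.keys f \<subseteq> A"
  shows "eval_at a f = (\<Sum>m\<in>A. Poly_Mapping.lookup f m *
     (\<Prod>v\<in>UNIV. (a $ v) ^ Poly_Mapping.lookup m v))"
  unfolding eval_at_def using assms
  by (intro sum.mono_neutral_left) (auto simp: in_keys_iff)

lemma eval_at_zero [simp]: "eval_at a 0 = 0"
  by (simp add: eval_at_def)

lemma eval_at_single:
  "eval_at a (Poly_Mapping.single m c) = c * (\<Prod>v\<in>UNIV. (a $ v) ^ Poly_Mapping.lookup m v)"
  by (subst eval_at_superset[of "{m}"]) auto

lemma eval_at_add: "eval_at a (f + g) = eval_at a f + eval_at a g"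
proof -
  let ?A = "Poly_Mapping.keys f \<union> Poly_Mapping.keys g"
  have "Poly_Mapping.keys (f + g) \<subseteq> ?A" by (rule keys_add)
  then show ?thesis
    by (subst (1 2 3) eval_at_superset[of ?A])
      (auto simp: lookup_add distrib_right sum.distrib)
qed

lemma eval_at_mult: "eval_at a (f * g) = eval_at a f * eval_at a g"
proof (induction f rule: mpoly_add_single_induct)
  case (single m c)
  show ?case
  proof (induction g rule: mpoly_add_single_induct)
    case (single m' c')
    show ?case
      by (simp add: mult_single eval_at_single lookup_add power_add prod.distrib mult_ac)
  qed (simp_all add: eval_at_add distrib_left)
qed (simp_all add: eval_at_add distrib_right)

lemma eval_at_const [simp]: "eval_at a (const c) = c"
  by (simp add: const_def eval_at_single)

lemma eval_at_var [simp]: "eval_at a (var v) = a $ v"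
proof -
  have "(\<Prod>w\<in>UNIV. (a $ w) ^ Poly_Mapping.lookup (Poly_Mapping.single v 1) w) =
      (\<Prod>w\<in>UNIV. if w = v then a $ w else 1)"
    by (intro prod.cong) (auto simp: lookup_single)
  then show ?thesis by (simp add: var_def eval_at_single)
qed

lemma eval_at_sum: "eval_at a (sum f A) = (\<Sum>x\<in>A. eval_at a (f x))"
  by (induction A rule: infinite_finite_induct) (auto simp: eval_at_add)

lemma eval_at_one [simp]: "eval_at a 1 = 1"
  using eval_at_const[of a 1] by simp

lemma eval_at_prod: "eval_at a (prod f A) = (\<Prod>x\<in>A. eval_at a (f x))"
  by (induction A rule: infinite_finite_induct) (auto simp: eval_at_mult)

lemma eval_at_power: "eval_at a (f ^ k) = eval_at a f ^ k"
  by (induction k) (auto simp: eval_at_mult)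

lemma eval_at_diff:
  fixes f g :: "('v::finite, 'k::comm_ring_1) mpoly"
  shows "eval_at a (f - g) = eval_at a f - eval_at a g"
  using eval_at_add[of a "f - g" g] by simp

lemma eval_at_linear_form: "eval_at a (linear_form c) = (\<Sum>v\<in>UNIV. c $ v * a $ v)"
  by (simp add: linear_form_def eval_at_sum eval_at_mult)

section \<open>Homogeneous forms\<close>

lemma mdeg_add: "mdeg (p + q) = mdeg p + mdeg q"
  by (simp add: mdeg_def lookup_add sum.distrib)

lemma homogeneous_zero [simp]: "homogeneous d 0"
  by (simp add: homogeneous_def)

lemma homogeneous_const [simp]: "homogeneous 0 (const c)"
  by (auto simp: homogeneous_def const_def mdeg_def)

lemma homogeneous_one [simp]: "homogeneous 0 (1 :: ('v::finite, 'k::zero_neq_one) mpoly)"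
  by (simp add: homogeneous_def mdeg_def)

lemma homogeneous_var: "homogeneous 1 (var v)"
  by (auto simp: homogeneous_def var_def mdeg_def lookup_single when_def)

lemma homogeneous_add: "homogeneous d f \<Longrightarrow> homogeneous d g \<Longrightarrow> homogeneous d (f + g)"
  using keys_add[of f g] by (auto simp: homogeneous_def)

lemma homogeneous_mult: "homogeneous d f \<Longrightarrow> homogeneous e g \<Longrightarrow> homogeneous (d + e) (f * g)"
  using keys_mult[of f g] by (fastforce simp: homogeneous_def mdeg_add)

lemma homogeneous_const_mult: "homogeneous d f \<Longrightarrow> homogeneous d (const c * f)"
  using homogeneous_mult[OF homogeneous_const] by fastforce

lemma homogeneous_diff:
  fixes f g :: "('v::finite, 'k::comm_ring_1) mpoly"
  shows "homogeneous d f \<Longrightarrow> homogeneous d g \<Longrightarrow> homogeneous d (f - g)"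
  using keys_diff[of f g] by (auto simp: homogeneous_def)

lemma homogeneous_sum:
  "(\<And>x. x \<in> A \<Longrightarrow> homogeneous d (f x)) \<Longrightarrow> homogeneous d (sum f A)"
  by (induction A rule: infinite_finite_induct) (auto intro: homogeneous_add)

lemma homogeneous_prod:
  "(\<And>x. x \<in> A \<Longrightarrow> homogeneous 1 (f x)) \<Longrightarrow> homogeneous (card A) (prod f A)"
  using homogeneous_mult[of 1] by (induction A rule: infinite_finite_induct) auto

lemma homogeneous_power: "homogeneous 1 f \<Longrightarrow> homogeneous k (f ^ k)"
  using homogeneous_mult[of 1 f] by (induction k) auto

lemma homogeneous_linear_form: "homogeneous 1 (linear_form c)"
  unfolding linear_form_def
  by (intro homogeneous_sum homogeneous_const_mult homogeneous_var)

text \<open>Each monomial of degree \<open>d\<close> gains the factor \<open>c ^ d\<close>. Hence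
  the vanishing of a form at a projective point can be tested on one representative.\<close>

lemma eval_at_scale_homogeneous:
  assumes "homogeneous d f"
  shows "eval_at (c *s a) f = c ^ d * eval_at a f"
proof -
  have "(\<Prod>v\<in>UNIV. ((c *s a) $ v) ^ Poly_Mapping.lookup m v) =
      c ^ mdeg m * (\<Prod>v\<in>UNIV. (a $ v) ^ Poly_Mapping.lookup m v)" for m
    by (simp add: power_mult_distrib prod.distrib mdeg_def power_sum)
  then show ?thesis
    using assms by (auto simp: eval_at_def homogeneous_def sum_distrib_left mult_ac intro!: sum.cong)
qed

section \<open>Partial derivatives of products and of powers of linear forms\<close>

lemma partial_deriv_add: "partial_deriv v (f + g) = partial_deriv v f + partial_deriv v g"
  by (rule poly_mapping_eqI) (simp add: lookup_partial_deriv lookup_add algebra_simps)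

lemma partial_deriv_zero [simp]: "partial_deriv v 0 = 0"
  by (simp add: partial_deriv_def)

lemma partial_deriv_const_mult: "partial_deriv v (const c * f) = const c * partial_deriv v f"
  by (rule poly_mapping_eqI) (simp add: lookup_partial_deriv lookup_const_mult mult.left_commute)

lemma partial_deriv_single:
  "partial_deriv v (Poly_Mapping.single m c) =
     Poly_Mapping.single (m - Poly_Mapping.single v 1) (of_nat (Poly_Mapping.lookup m v) * c)"
  by (cases "c = 0") (auto simp: partial_deriv_def)

text \<open>Both sides are additive in \<open>f\<close> and in \<open>g\<close>, which leaves the
  case of two monomials, where the exponents of \<open>v\<close> add.\<close>

lemma partial_deriv_mult:
  "partial_deriv v (f * g) = partial_deriv v f * g + f * partial_deriv v g"
proof (induction f rule: mpoly_add_single_induct)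
  case (single m c)
  show ?case
  proof (induction g rule: mpoly_add_single_induct)
    case (single m' c')
    let ?e = "Poly_Mapping.single v (1::nat)"
    \<comment> \<open>Subtraction of exponents is truncated and may fail to commute with adding
      \<open>q\<close> when \<open>v\<close> does not occur in \<open>p\<close>. In that case the
      coefficients in \<open>mult\<close> below are zero.\<close>
    have shift: "p - ?e + q = p + q - ?e" if "Poly_Mapping.lookup p v \<noteq> 0" for p q
      using that
      by (intro poly_mapping_eqI) (auto simp: lookup_add lookup_minus lookup_single when_def)
    have mult: "Poly_Mapping.single (p - ?e) (of_nat (Poly_Mapping.lookup p v) * x) *
        Poly_Mapping.single q y =
        Poly_Mapping.single (p + q - ?e) (of_nat (Poly_Mapping.lookup p v) * (x * y))" for p q x y
      using shift[of p q]
      by (cases "Poly_Mapping.lookup p v = 0") (auto simp: mult_single mult_ac)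
    have "Poly_Mapping.single m c *
        Poly_Mapping.single (m' - ?e) (of_nat (Poly_Mapping.lookup m' v) * c') =
        Poly_Mapping.single (m + m' - ?e) (of_nat (Poly_Mapping.lookup m' v) * (c * c'))"
      using mult[of m' c' m c] by (simp only: mult.commute add.commute)
    then show ?case
      by (simp only: partial_deriv_single mult mult_single[of m c m' c'] lookup_add of_nat_add
          distrib_right single_add)
  qed (simp_all add: partial_deriv_add algebra_simps)
qed (simp_all add: partial_deriv_add algebra_simps)

lemma partial_deriv_linear_form: "partial_deriv v (linear_form a) = const (a $ v)"
proof -
  have sum: "partial_deriv v (sum f A) = (\<Sum>w\<in>A. partial_deriv v (f w))"
    for f :: "'a \<Rightarrow> ('a, 'b) mpoly" and A
    by (induction A rule: infinite_finite_induct) (auto simp: partial_deriv_add)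
  have "partial_deriv v (var w) = (if w = v then 1 else 0 :: ('a, 'b) mpoly)" for w
    by (auto simp: var_def partial_deriv_single lookup_single)
  then have "partial_deriv v (linear_form a) = (\<Sum>w\<in>UNIV. if w = v then const (a $ w) else 0)"
    unfolding linear_form_def sum partial_deriv_const_mult by (intro sum.cong) auto
  then show ?thesis by simp
qed

lemma partial_deriv_power_linear_form:
  "partial_deriv v (linear_form a ^ Suc k) = const (of_nat (Suc k) * a $ v) * linear_form a ^ k"
proof (induction k)
  case 0
  show ?case by (simp add: partial_deriv_linear_form)
next
  case (Suc k)
  have "partial_deriv v (linear_form a ^ Suc (Suc k)) =
      (const (a $ v) + const (of_nat (Suc k) * a $ v)) * linear_form a ^ Suc k"
    by (subst power_Suc, subst partial_deriv_mult, subst Suc.IH)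
      (simp add: partial_deriv_linear_form algebra_simps)
  also have "const (a $ v) + const (of_nat (Suc k) * a $ v) =
      (const (of_nat (Suc (Suc k)) * a $ v) :: ('a, 'b) mpoly)"
    by (simp add: const_def single_add[symmetric] algebra_simps)
  finally show ?case .
qed

lemma funpow_partial_deriv_const_mult:
  "(partial_deriv v ^^ k) (const c * f) = const c * (partial_deriv v ^^ k) f"
  by (induction k) (simp_all add: partial_deriv_const_mult)

text \<open>Each derivative brings down the current exponent; the falling factorial collected after
  \<open>k\<close> steps is written as a quotient of factorials, which characteristic zero
  permits.\<close>

lemma funpow_partial_deriv_power_linear_form:
  fixes a :: "'k::field_char_0^'v::finite"
  assumes "k \<le> N"
  shows "(partial_deriv v ^^ k) (linear_form a ^ N) =
    const (fact N / fact (N - k) * (a $ v) ^ k) * linear_form a ^ (N - k)"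
  using assms
proof (induction k)
  case 0
  then show ?case by simp
next
  case (Suc k)
  then obtain j where j: "N - k = Suc j" "N - Suc k = j"
    by (metis Suc_diff_Suc Suc_le_lessD)
  have "(fact N / fact (Suc j) * (a $ v) ^ k) * (of_nat (Suc j) * a $ v) =
      fact N / fact j * (a $ v) ^ Suc k"
    by (simp add: field_simps del: of_nat_Suc)
  then show ?case
    using Suc
    by (simp only: funpow.simps comp_apply j partial_deriv_const_mult
        partial_deriv_power_linear_form mult.assoc[symmetric] const_mult[symmetric]
        Suc_leD)
qed

text \<open>By induction over the set of variables: each new variable acts on the power left by the
  others, and the quotients of factorials telescope. The case \<open>UNIV\<close> evaluates
  \<open>monom_deriv\<close>.\<close>

lemma fold_partial_deriv_power_linear_form:
  fixes a :: "'k::field_char_0^'v::finite"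
  assumes "finite A" "sum k A \<le> N"
  shows "Finite_Set.fold (\<lambda>v. partial_deriv v ^^ k v) (linear_form a ^ N) A =
    const (fact N / fact (N - sum k A) * (\<Prod>v\<in>A. (a $ v) ^ k v)) * linear_form a ^ (N - sum k A)"
  using assms
proof (induction A)
  case empty
  then show ?case by simp
next
  case (insert x A)
  interpret comp_fun_commute "\<lambda>v. partial_deriv v ^^ k v"
    by (rule partial_deriv_pow_comp_fun_commute)
  have le: "sum k A \<le> N" "k x \<le> N - sum k A" "N - sum k A - k x = N - sum k (insert x A)"
    using insert by auto
  have "fact N / fact (N - sum k A) * (\<Prod>v\<in>A. (a $ v) ^ k v) *
      (fact (N - sum k A) / fact (N - sum k (insert x A)) * (a $ x) ^ k x) =
      fact N / fact (N - sum k (insert x A)) * (\<Prod>v\<in>insert x A. (a $ v) ^ k v)"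
    using insert by simp
  then show ?case
    by (simp only: fold_insert[OF insert.hyps] insert.IH[OF le(1)] comp_apply
        funpow_partial_deriv_const_mult funpow_partial_deriv_power_linear_form[OF le(2)] le(3)
        mult.assoc[symmetric] const_mult[symmetric])
qed

text \<open>All monomials of \<open>f\<close> have the same degree, so they produce the same
  factorial quotient and the same remaining power; what is left of the sum is the value of
  \<open>f\<close> at \<open>a\<close>.\<close>

lemma diff_action_power_linear_form:
  fixes a :: "'k::field_char_0^'v::finite"
  assumes "homogeneous d f" "d \<le> N"
  shows "diff_action f (linear_form a ^ N) =
    const (fact N / fact (N - d) * eval_at a f) * linear_form a ^ (N - d)"
proof -
  have "monom_deriv m (linear_form a ^ N) =
      const (fact N / fact (N - d) * (\<Prod>v\<in>UNIV. (a $ v) ^ Poly_Mapping.lookup m v)) *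
        linear_form a ^ (N - d)"
    if "m \<in> Poly_Mapping.keys f" for m
    using that assms fold_partial_deriv_power_linear_form[of UNIV "Poly_Mapping.lookup m" N a]
    by (auto simp: monom_deriv_def homogeneous_def mdeg_def)
  then have "diff_action f (linear_form a ^ N) = (\<Sum>m\<in>Poly_Mapping.keys f.
      const (fact N / fact (N - d) * (Poly_Mapping.lookup f m *
        (\<Prod>v\<in>UNIV. (a $ v) ^ Poly_Mapping.lookup m v))) * linear_form a ^ (N - d))"
    unfolding diff_action_def
    by (intro sum.cong refl) (simp only: const_mult mult_ac)
  then show ?thesis
    by (simp only: eval_at_def sum_distrib_left const_sum sum_distrib_right)
qed

lemma monom_deriv_add: "monom_deriv m (f + g) = monom_deriv m f + monom_deriv m g"
  and monom_deriv_const_mult: "monom_deriv m (const c * f) = const c * monom_deriv m f"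
proof -
  interpret comp_fun_commute "\<lambda>v. partial_deriv v ^^ Poly_Mapping.lookup m v"
    by (rule partial_deriv_pow_comp_fun_commute)
  have pow: "(partial_deriv v ^^ k) (f + g) = (partial_deriv v ^^ k) f + (partial_deriv v ^^ k) g"
    for v :: 'a and k and f g :: "('a, 'b) mpoly"
    by (induction k) (simp_all add: partial_deriv_add)
  let ?fold = "Finite_Set.fold (\<lambda>v. partial_deriv v ^^ Poly_Mapping.lookup m v)"
  have "finite A \<Longrightarrow> ?fold (f + g) A = ?fold f A + ?fold g A" for A
    by (induction A rule: finite_induct) (simp_all add: pow)
  then show "monom_deriv m (f + g) = monom_deriv m f + monom_deriv m g"
    by (simp add: monom_deriv_def)
  have "finite A \<Longrightarrow> ?fold (const c * f) A = const c * ?fold f A" for A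
    by (induction A rule: finite_induct) (simp_all add: funpow_partial_deriv_const_mult)
  then show "monom_deriv m (const c * f) = const c * monom_deriv m f"
    by (simp add: monom_deriv_def)
qed

lemma diff_action_add: "diff_action f (g + h) = diff_action f g + diff_action f h"
  by (simp add: diff_action_def monom_deriv_add distrib_left sum.distrib)

lemma diff_action_const_mult: "diff_action f (const c * g) = const c * diff_action f g"
  by (simp add: diff_action_def monom_deriv_const_mult sum_distrib_left mult.left_commute)

lemma diff_action_sum: "diff_action f (sum g A) = (\<Sum>x\<in>A. diff_action f (g x))"
proof -
  have "diff_action f 0 = 0"
    using diff_action_const_mult[of f 0 0] by simp
  then show ?thesis
    by (induction A rule: infinite_finite_induct) (auto simp: diff_action_add)
qed


subsection \<open>Points, hyperplanes and vanishing forms\<close>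

text \<open>As \<open>c\<close> runs through the nonzero scalars, so does \<open>c * d\<close>; any
  representative therefore yields the same projective point.\<close>

lemma scalar_multiples_eq:
  fixes x :: "'k::field^'v::finite"
  assumes "d \<noteq> 0"
  shows "{c *s (d *s x) |c. c \<noteq> 0} = {c *s x |c. c \<noteq> 0}"
proof (intro set_eqI iffI; elim CollectE exE conjE)
  fix y c assume "y = c *s (d *s x)" "c \<noteq> 0"
  then show "y \<in> {c *s x |c. c \<noteq> 0}"
    using assms by (auto simp: vector_smult_assoc intro!: exI[of _ "c * d"])
next
  fix y c assume "y = c *s x" "c \<noteq> 0"
  then show "y \<in> {c *s (d *s x) |c. c \<noteq> 0}"
    using assms by (auto simp: vector_smult_assoc intro!: exI[of _ "c / d"])
qed

text \<open>The vector \<open>axis w p - axis v q\<close> holds the coefficients of the linear form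
  p x_w - q x_v. With entries of a vector as p and q, its values are 2 by 2 minors.\<close>

lemma sum_axis_diff_mult:
  fixes y :: "'k::ring_1^'v::finite"
  shows "(\<Sum>x\<in>UNIV. (axis w p - axis v q) $ x * y $ x) = p * y $ w - q * y $ v"
proof -
  have "(\<Sum>x\<in>UNIV. (axis w p - axis v q) $ x * y $ x) =
      (\<Sum>x\<in>UNIV. (if x = w then p * y $ x else 0) - (if x = v then q * y $ x else 0))"
    by (intro sum.cong) (auto simp: axis_def left_diff_distrib)
  then show ?thesis by (simp add: sum_subtractf)
qed

lemma proj_space_class:
  fixes p :: "('k::field^'v::finite) set"
  assumes "p \<in> proj_space" "a \<in> p"
  shows "a \<noteq> 0" and "p = {c *s a |c. c \<noteq> 0}"
proof -
  obtain x where x: "x \<noteq> 0" "p = proportional `` {x}"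
    using assms(1) by (auto simp: proj_space_def quotient_def)
  then have p: "p = {c *s x |c. c \<noteq> 0}"
    by (auto simp: proportional_def)
  then obtain d where d: "d \<noteq> 0" "a = d *s x"
    using assms(2) by auto
  then show "a \<noteq> 0"
    using x by (simp add: vector_mul_eq_0)
  show "p = {c *s a |c. c \<noteq> 0}"
    unfolding p d(2) scalar_multiples_eq[OF d(1)] ..
qed

text \<open>With b_v nonzero, the vanishing of all minors b_v a_w - b_w a_v would make a the
  multiple (a_v / b_v) b. A nonzero minor is the value at a of the form b_v x_w - b_w x_v, which
  vanishes at b.\<close>

lemma exists_linear_form_separating:
  fixes a b :: "'k::field^'v::finite"
  assumes "a \<noteq> 0" "b \<noteq> 0" "\<And>c. c \<noteq> 0 \<Longrightarrow> a \<noteq> c *s b"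
  obtains c where "eval_at a (linear_form c) \<noteq> 0" "eval_at b (linear_form c) = 0"
proof -
  obtain v where v: "b $ v \<noteq> 0"
    using assms(2) by (auto simp: vec_eq_iff)
  have "\<exists>w. b $ v * a $ w \<noteq> b $ w * a $ v"
  proof (rule ccontr)
    assume "\<nexists>w. b $ v * a $ w \<noteq> b $ w * a $ v"
    then have "a = (a $ v / b $ v) *s b"
      using v by (auto simp: vec_eq_iff field_simps)
    moreover from this have "a $ v / b $ v \<noteq> 0"
      using assms(1) by (metis vector_smult_lzero)
    ultimately show False using assms(3) by blast
  qed
  then obtain w where w: "b $ v * a $ w \<noteq> b $ w * a $ v" ..
  with that[of "axis w (b $ v) - axis v (b $ w)"] show thesis
    by (simp only: eval_at_linear_form sum_axis_diff_mult) simp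
qed

lemma exists_linear_form_nonzero:
  fixes a :: "'k::field^'v::finite"
  assumes "a \<noteq> 0"
  obtains c where "eval_at a (linear_form c) \<noteq> 0"
proof -
  obtain v where v: "a $ v \<noteq> 0"
    using assms by (auto simp: vec_eq_iff)
  \<comment> \<open>This is the coordinate form of \<open>v\<close>; the zero vector
    \<open>axis v 0\<close> brings it into the shape treated by
    \<open>sum_axis_diff_mult\<close>.\<close>
  with that[of "axis v 1 - axis v 0"] show thesis
    by (simp only: eval_at_linear_form sum_axis_diff_mult) simp
qed

text \<open>A coordinate \<open>v\<close> with a_v nonzero and a second coordinate \<open>w\<close>
  give the nonzero form a_v x_w - a_w x_v, which vanishes at the point. This will rule out a set
  consisting of one point.\<close>

lemma point_in_hyperplane:
  fixes p :: "('k::field^'v::finite) set"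
  assumes "CARD('v) \<ge> 2" "p \<in> proj_space"
  shows "\<exists>H. hyperplane H \<and> p \<in> H"
proof -
  obtain a where a: "a \<noteq> 0" "p = proportional `` {a}"
    using assms(2) by (auto simp: proj_space_def quotient_def)
  then have "1 *s a \<in> p"
    by (auto simp: proportional_def simp del: vector_smult_lid intro: exI[of _ 1])
  then have p: "p = {c *s a |c. c \<noteq> 0}"
    using proj_space_class[OF assms(2), of a] by simp
  obtain v where v: "a $ v \<noteq> 0"
    using a(1) by (auto simp: vec_eq_iff)
  have "UNIV \<noteq> {v}"
  proof
    assume "UNIV = {v}"
    then have "CARD('v) = card {v}" by (rule arg_cong)
    with assms(1) show False by simp
  qed
  then obtain w where w: "w \<noteq> v" by auto
  define c where "c = axis w (a $ v) - axis v (a $ w)"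
  have "c $ w = a $ v"
    using w by (simp add: c_def axis_def)
  then have "c \<noteq> 0" using v by auto
  have "\<forall>b\<in>p. (\<Sum>x\<in>UNIV. c $ x * b $ x) = 0"
    unfolding p c_def sum_axis_diff_mult by auto
  with \<open>c \<noteq> 0\<close> assms(2) show ?thesis
    unfolding hyperplane_def by blast
qed

text \<open>The polynomials vanishing at all representatives form an ideal containing the
  generators, which bounds the span; conversely, a vanishing form is itself a generator.\<close>

lemma homogeneous_in_ideal_of_iff:
  fixes f :: "('v::finite, 'k::field) mpoly"
  assumes "homogeneous d f"
  shows "f \<in> ideal_of X \<longleftrightarrow> (\<forall>p\<in>X. \<forall>a\<in>p. eval_at a f = 0)"
proof -
  interpret module "(*) :: ('v, 'k) mpoly \<Rightarrow> ('v, 'k) mpoly \<Rightarrow> ('v, 'k) mpoly"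
    by (rule module_mult)
  let ?Z = "{f :: ('v, 'k) mpoly. \<forall>p\<in>X. \<forall>a\<in>p. eval_at a f = 0}"
  have "subspace ?Z"
    by (auto simp: subspace_def eval_at_add eval_at_mult)
  then have "ideal_of X \<subseteq> ?Z"
    unfolding ideal_of_def by (intro span_minimal) auto
  moreover have "f \<in> ideal_of X" if "f \<in> ?Z"
    unfolding ideal_of_def using that assms by (intro span_base) auto
  ultimately show ?thesis by auto
qed

subsection \<open>The Hilbert function as the rank of the evaluation map\<close>

text \<open>Functions with pointwise operations model a coordinate space with one axis per point, so
  that dimension theory over an arbitrary field applies to vectors of values.\<close>

definition fun_scale :: "'k::times \<Rightarrow> ('i \<Rightarrow> 'k) \<Rightarrow> 'i \<Rightarrow> 'k" where
  "fun_scale c \<phi> = (\<lambda>i. c * \<phi> i)"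

interpretation fun_space: vector_space "fun_scale :: 'k::field \<Rightarrow> ('i \<Rightarrow> 'k) \<Rightarrow> 'i \<Rightarrow> 'k"
  by unfold_locales (auto simp: fun_scale_def fun_eq_iff algebra_simps)

lemma sum_fun_apply: "(\<Sum>x\<in>A. f x) i = (\<Sum>x\<in>A. f x i)"
  by (induction A rule: infinite_finite_induct) auto

definition unit_fun :: "'i \<Rightarrow> 'i \<Rightarrow> 'k::zero_neq_one" where
  "unit_fun i = (\<lambda>j. if j = i then 1 else 0)"

lemma inj_unit_fun: "inj_on unit_fun A"
  by (rule inj_onI) (metis unit_fun_def zero_neq_one)

lemma sum_unit_fun:
  fixes c :: "'i \<Rightarrow> 'k::field"
  assumes "finite I"
  shows "(\<Sum>i\<in>I. fun_scale (c i) (unit_fun i)) = (\<lambda>i. if i \<in> I then c i else 0)"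
  using assms by (auto simp: fun_eq_iff sum_fun_apply fun_scale_def unit_fun_def if_distrib[of "(*) _"]
      cong: if_cong)

lemma independent_unit_fun:
  assumes "finite I"
  shows "fun_space.independent (unit_fun ` I :: ('i \<Rightarrow> 'k::field) set)"
proof (rule fun_space.independent_if_scalars_zero)
  show "finite (unit_fun ` I :: ('i \<Rightarrow> 'k) set)" using assms by simp
  fix c :: "('i \<Rightarrow> 'k) \<Rightarrow> 'k" and x :: "'i \<Rightarrow> 'k"
  assume "(\<Sum>x\<in>unit_fun ` I. fun_scale (c x) x) = 0" and x: "x \<in> unit_fun ` I"
  then have "(\<Sum>i\<in>I. fun_scale (c (unit_fun i)) (unit_fun i)) = 0"
    by (simp add: sum.reindex inj_unit_fun)
  then have "(\<lambda>i. if i \<in> I then c (unit_fun i) else 0) = 0"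
    by (simp only: sum_unit_fun[OF assms, of "\<lambda>i. c (unit_fun i)"])
  with x show "c x = 0" by (auto simp: fun_eq_iff split: if_splits)
qed

lemma span_unit_fun:
  assumes "finite I"
  shows "fun_space.span (unit_fun ` I) = {\<phi> :: 'i \<Rightarrow> 'k::field. \<forall>i. i \<notin> I \<longrightarrow> \<phi> i = 0}"
proof
  have "fun_space.subspace {\<phi> :: 'i \<Rightarrow> 'k. \<forall>i. i \<notin> I \<longrightarrow> \<phi> i = 0}"
    by (auto simp: fun_space.subspace_def fun_scale_def)
  then show "fun_space.span (unit_fun ` I) \<subseteq> {\<phi> :: 'i \<Rightarrow> 'k. \<forall>i. i \<notin> I \<longrightarrow> \<phi> i = 0}"
    by (intro fun_space.span_minimal) (auto simp: unit_fun_def)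
  show "{\<phi> :: 'i \<Rightarrow> 'k. \<forall>i. i \<notin> I \<longrightarrow> \<phi> i = 0} \<subseteq> fun_space.span (unit_fun ` I)"
  proof safe
    fix \<phi> :: "'i \<Rightarrow> 'k"
    assume "\<forall>i. i \<notin> I \<longrightarrow> \<phi> i = 0"
    then have "\<phi> = (\<Sum>i\<in>I. fun_scale (\<phi> i) (unit_fun i))"
      by (auto simp: sum_unit_fun[OF assms])
    also have "\<dots> \<in> fun_space.span (unit_fun ` I)"
      by (intro fun_space.span_sum fun_space.span_scale fun_space.span_base) auto
    finally show "\<phi> \<in> fun_space.span (unit_fun ` I)" .
  qed
qed

text \<open>A unit function outside \<open>V\<close> would extend a basis of \<open>V\<close> to
  \<open>card I + 1\<close> independent vectors in a space spanned by \<open>card I\<close> vectors.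
  Conversely, unit functions contained in \<open>V\<close> form a basis of it.\<close>

lemma subspace_dim_eq_card_iff:
  fixes V :: "('i \<Rightarrow> 'k::field) set"
  assumes "finite I" "fun_space.subspace V" "V \<subseteq> {\<phi>. \<forall>i. i \<notin> I \<longrightarrow> \<phi> i = 0}"
  shows "fun_space.dim V = card I \<longleftrightarrow> unit_fun ` I \<subseteq> V"
proof
  have card: "card (unit_fun ` I :: ('i \<Rightarrow> 'k) set) = card I"
    by (intro card_image inj_unit_fun)
  have V: "V \<subseteq> fun_space.span (unit_fun ` I)"
    using assms by (simp add: span_unit_fun)
  show "fun_space.dim V = card I" if "unit_fun ` I \<subseteq> V"
    using that V independent_unit_fun[OF assms(1)] card by (rule fun_space.dim_unique)
  assume dim: "fun_space.dim V = card I"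
  obtain B where B: "B \<subseteq> V" "fun_space.independent B" "V \<subseteq> fun_space.span B" "card B = card I"
    using fun_space.basis_exists[of V] dim by metis
  show "unit_fun ` I \<subseteq> V"
  proof (rule ccontr)
    assume "\<not> unit_fun ` I \<subseteq> V"
    then obtain x where x: "x \<in> unit_fun ` I" "x \<notin> V" by blast
    then have "x \<notin> fun_space.span B"
      using fun_space.span_minimal[OF B(1) assms(2)] by blast
    then have ind: "fun_space.independent (insert x B)"
      using B(2) by (rule fun_space.independent_insertI)
    have sub: "insert x B \<subseteq> fun_space.span (unit_fun ` I)"
      using B(1) V x by (auto intro: fun_space.span_base)
    have "finite (insert x B) \<and> card (insert x B) \<le> card (unit_fun ` I :: ('i \<Rightarrow> 'k) set)"
      using assms(1) by (intro fun_space.independent_span_bound ind sub) simp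
    moreover have "x \<notin> B" using x B(1) by blast
    ultimately show False using B(4) card by auto
  qed
qed

section \<open>Evaluation of forms at chosen coordinate vectors of the points\<close>

locale projective_points =
  fixes I :: "'i set" and P :: "'i \<Rightarrow> ('k::field^'v::finite) set" and a :: "'i \<Rightarrow> 'k^'v"
  assumes finite_index: "finite I"
    and point: "i \<in> I \<Longrightarrow> P i \<in> proj_space"
    and distinct: "inj_on P I"
    and coordinates: "i \<in> I \<Longrightarrow> a i \<in> P i"
begin

text \<open>A form has no well-defined value at a projective point, so the values refer to the
  chosen vectors. Padding with 0 off \<open>I\<close> places them in the span of the unit
  functions.\<close>

definition "values" :: "('v, 'k) mpoly \<Rightarrow> 'i \<Rightarrow> 'k" where
  "values f = (\<lambda>i. if i \<in> I then eval_at (a i) f else 0)"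

text \<open>The kernel of evaluation in degree \<open>d\<close> is the degree-\<open>d\<close> part
  of the ideal, so this image is a copy of the degree-\<open>d\<close> part of the coordinate
  ring.\<close>

definition value_space :: "nat \<Rightarrow> ('i \<Rightarrow> 'k) set" where
  "value_space d = values ` {f. homogeneous d f}"

lemma values_add: "values (f + g) = values f + values g"
  and values_diff: "values (f - g) = values f - values g"
  and values_const_mult: "values (const c * f) = fun_scale c (values f)"
  by (auto simp: values_def eval_at_add eval_at_diff eval_at_mult fun_scale_def fun_eq_iff)

lemma values_zero [simp]: "values 0 = 0"
  by (auto simp: values_def)

lemma values_sum: "values (sum f A) = (\<Sum>x\<in>A. values (f x))"
  by (induction A rule: infinite_finite_induct) (auto simp: values_add)

lemma values_combination:
  "values (\<Sum>b\<in>B. const (c b) * b) = (\<Sum>b\<in>B. fun_scale (c b) (values b))"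
  by (simp add: values_sum values_const_mult)

lemma subspace_value_space: "fun_space.subspace (value_space d)"
  unfolding fun_space.subspace_def
proof (intro conjI ballI allI)
  show "0 \<in> value_space d"
    unfolding value_space_def by (rule image_eqI[of _ _ 0]) auto
next
  fix x y assume "x \<in> value_space d" "y \<in> value_space d"
  then show "x + y \<in> value_space d"
    unfolding value_space_def by (auto simp: homogeneous_add simp flip: values_add)
next
  fix c x assume "x \<in> value_space d"
  then show "fun_scale c x \<in> value_space d"
    unfolding value_space_def
    by (auto simp: homogeneous_const_mult simp flip: values_const_mult)
qed

lemma value_space_support: "value_space d \<subseteq> {\<phi>. \<forall>i. i \<notin> I \<longrightarrow> \<phi> i = 0}"
  by (auto simp: value_space_def values_def)

text \<open>Rescaling a representative multiplies the value of a form by a power of the scalar, so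
  one vector per point decides membership. This identifies the kernel of evaluation.\<close>

lemma homogeneous_in_ideal_iff_values:
  assumes "homogeneous d f"
  shows "f \<in> ideal_of (P ` I) \<longleftrightarrow> values f = 0"
proof -
  have "(\<forall>b\<in>P i. eval_at b f = 0) \<longleftrightarrow> eval_at (a i) f = 0" if "i \<in> I" for i
  proof
    show "eval_at (a i) f = 0" if "\<forall>b\<in>P i. eval_at b f = 0"
      using that coordinates[OF \<open>i \<in> I\<close>] by blast
    have P: "P i = {c *s a i |c. c \<noteq> 0}"
      using that by (intro proj_space_class point coordinates)
    show "\<forall>b\<in>P i. eval_at b f = 0" if "eval_at (a i) f = 0"
      unfolding P using that by (auto simp: eval_at_scale_homogeneous[OF assms])
  qed
  then show ?thesis
    by (auto simp: homogeneous_in_ideal_of_iff[OF assms] values_def fun_eq_iff)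
qed

lemma homogeneous_combination:
  assumes "\<forall>b\<in>B. homogeneous d b"
  shows "homogeneous d (\<Sum>b\<in>B. const (c b) * b)"
  using assms by (intro homogeneous_sum homogeneous_const_mult) auto

text \<open>Evaluation identifies the quotient in degree \<open>d\<close> with the value space and
  carries \<open>B\<close> to a basis of it. All quotient bases thus have the same size, and the
  choice made by \<open>SOME\<close> does not matter.\<close>

lemma card_quotient_basis:
  assumes "quotient_basis (ideal_of (P ` I)) d B"
  shows "card B = fun_space.dim (value_space d)"
proof -
  \<comment> \<open>Replacing membership in the ideal by vanishing of values turns the two quotient
    conditions into independence and spanning of the value vectors.\<close>
  have fin: "finite B" and hom: "\<forall>b\<in>B. homogeneous d b"
    and ind: "\<And>c. (\<Sum>b\<in>B. fun_scale (c b) (values b)) = 0 \<Longrightarrow> \<forall>b\<in>B. c b = 0"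
    and gen: "\<And>f. homogeneous d f \<Longrightarrow> \<exists>c. values f = (\<Sum>b\<in>B. fun_scale (c b) (values b))"
  proof -
    show "finite B" "\<forall>b\<in>B. homogeneous d b"
      using assms by (auto simp: quotient_basis_def)
    note hom = homogeneous_combination[OF this(2)]
    show "\<forall>b\<in>B. c b = 0" if "(\<Sum>b\<in>B. fun_scale (c b) (values b)) = 0" for c
      using assms that homogeneous_in_ideal_iff_values[OF hom, of c]
      by (auto simp: quotient_basis_def values_combination)
    show "\<exists>c. values f = (\<Sum>b\<in>B. fun_scale (c b) (values b))" if f: "homogeneous d f" for f
    proof -
      obtain c where "f - (\<Sum>b\<in>B. const (c b) * b) \<in> ideal_of (P ` I)"
        using assms f by (auto simp: quotient_basis_def)
      then show ?thesis
        using homogeneous_in_ideal_iff_values[OF homogeneous_diff[OF f hom], of c]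
        by (auto simp: values_diff values_combination)
    qed
  qed
  have inj: "inj_on values B"
  proof (rule inj_onI, rule ccontr)
    fix x y assume xy: "x \<in> B" "y \<in> B" "values x = values y" "x \<noteq> y"
    \<comment> \<open>Two forms with equal values would give the nontrivial relation with
      coefficient 1 at \<open>x\<close> and -1 at \<open>y\<close>.\<close>
    let ?c = "\<lambda>b. (if b = x then 1 else 0) - (if b = y then 1 else 0 :: 'k)"
    have "(\<Sum>b\<in>B. fun_scale (?c b) (values b)) = (\<Sum>b\<in>B. (if b = x then values b else 0) -
        (if b = y then values b else 0))"
      by (intro sum.cong) (auto simp: fun_scale_def fun_eq_iff)
    also have "\<dots> = 0"
      using xy fin by (simp add: sum_subtractf)
    finally have "\<forall>b\<in>B. ?c b = 0" by (rule ind)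
    from this xy(1) have "?c x = 0" by (rule bspec)
    then show False using xy by simp
  qed
  have "fun_space.dim (value_space d) = card B"
  proof (rule fun_space.dim_unique[of "values ` B"])
    show "values ` B \<subseteq> value_space d"
      using hom by (auto simp: value_space_def)
    show "card (values ` B) = card B"
      using inj by (rule card_image)
    show "value_space d \<subseteq> fun_space.span (values ` B)"
    proof
      fix x assume "x \<in> value_space d"
      then obtain c where "x = (\<Sum>b\<in>B. fun_scale (c b) (values b))"
        using gen by (auto simp: value_space_def)
      also have "\<dots> \<in> fun_space.span (values ` B)"
        by (intro fun_space.span_sum fun_space.span_scale fun_space.span_base) auto
      finally show "x \<in> fun_space.span (values ` B)" .
    qed
    show "fun_space.independent (values ` B)"
    proof (rule fun_space.independent_if_scalars_zero)
      fix c x assume "(\<Sum>x\<in>values ` B. fun_scale (c x) x) = 0" "x \<in> values ` B"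
      then show "c x = 0"
        using ind[of "c \<circ> values"] by (auto simp: sum.reindex[OF inj])
    qed (use fin in simp)
  qed
  then show ?thesis by simp
qed

text \<open>Lifting a basis of the value space to forms gives a quotient basis, so the
  \<open>SOME\<close> in \<open>hilbert_fun\<close> has a witness.\<close>

lemma exists_quotient_basis: "\<exists>B. quotient_basis (ideal_of (P ` I)) d B"
proof -
  obtain C where C: "C \<subseteq> value_space d" "fun_space.independent C"
    "value_space d \<subseteq> fun_space.span C"
    using fun_space.basis_exists[of "value_space d"] by metis
  have "C \<subseteq> fun_space.span (unit_fun ` I)"
    using C(1) value_space_support by (auto simp: span_unit_fun[OF finite_index])
  then have fin: "finite C"
    using fun_space.independent_span_bound[OF _ C(2)] finite_index by blast
  have "\<forall>x\<in>C. \<exists>f. homogeneous d f \<and> values f = x"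
    using C(1) by (auto simp: value_space_def)
  then obtain g where g: "\<And>x. x \<in> C \<Longrightarrow> homogeneous d (g x)" "\<And>x. x \<in> C \<Longrightarrow> values (g x) = x"
    by metis
  then have inj: "inj_on g C" by (metis inj_onI)
  have hom: "homogeneous d (\<Sum>b\<in>g ` C. const (c b) * b)" for c
    using g by (intro homogeneous_combination) auto
  have val: "values (\<Sum>b\<in>g ` C. const (c b) * b) = (\<Sum>x\<in>C. fun_scale (c (g x)) x)" for c
    unfolding values_combination by (subst sum.reindex[OF inj]) (auto simp: g intro: sum.cong)
  have "quotient_basis (ideal_of (P ` I)) d (g ` C)"
    unfolding quotient_basis_def
  proof (intro conjI allI impI)
    show "finite (g ` C)" "\<forall>b\<in>g ` C. homogeneous d b" using fin g by auto
  next
    fix c assume "(\<Sum>b\<in>g ` C. const (c b) * b) \<in> ideal_of (P ` I)"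
    then have "(\<Sum>x\<in>C. fun_scale (c (g x)) x) = 0"
      by (simp add: homogeneous_in_ideal_iff_values[OF hom] val)
    then show "\<forall>b\<in>g ` C. c b = 0"
      using fun_space.independentD[OF C(2) fin, of "\<lambda>x. c (g x)"] by blast
  next
    fix f :: "('v, 'k) mpoly" assume f: "homogeneous d f"
    then have "values f \<in> fun_space.span C"
      using C(3) by (auto simp: value_space_def)
    then obtain u where u: "values f = (\<Sum>x\<in>C. fun_scale (u x) x)"
      by (auto simp: fun_space.span_finite[OF fin])
    \<comment> \<open>The coefficients \<open>u\<close> belong to value vectors; composition with
      \<open>values\<close>, which inverts \<open>g\<close> on \<open>C\<close>, transports them to
      the lifted forms.\<close>
    have "values f = values (\<Sum>b\<in>g ` C. const ((u \<circ> values) b) * b)"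
      unfolding val u by (intro sum.cong) (auto simp: g)
    then show "\<exists>c. f - (\<Sum>b\<in>g ` C. const (c b) * b) \<in> ideal_of (P ` I)"
      by (intro exI[of _ "u \<circ> values"])
        (simp add: homogeneous_in_ideal_iff_values[OF homogeneous_diff[OF f hom]] values_diff)
  qed
  then show ?thesis ..
qed

lemma hilbert_fun_eq_dim: "hilbert_fun (P ` I) d = fun_space.dim (value_space d)"
  unfolding hilbert_fun_def
  using card_quotient_basis[OF someI_ex[OF exists_quotient_basis]] .

text \<open>Rank equal to the number of points means that evaluation is onto, which is tested on the
  unit functions.\<close>

lemma hilbert_fun_eq_card_iff: "hilbert_fun (P ` I) d = card I \<longleftrightarrow> unit_fun ` I \<subseteq> value_space d"
  unfolding hilbert_fun_eq_dim
  by (rule subspace_dim_eq_card_iff[OF finite_index subspace_value_space value_space_support])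

section \<open>Interpolation by forms and the socle degree\<close>

lemma unit_fun_in_value_space:
  assumes "i \<in> I" "homogeneous d f" "eval_at (a i) f \<noteq> 0"
    "\<And>j. j \<in> I \<Longrightarrow> j \<noteq> i \<Longrightarrow> eval_at (a j) f = 0"
  shows "unit_fun i \<in> value_space d"
  unfolding value_space_def
proof (rule image_eqI)
  show "unit_fun i = values (const (1 / eval_at (a i) f) * f)"
    using assms by (auto simp: unit_fun_def values_def eval_at_mult fun_eq_iff)
  show "const (1 / eval_at (a i) f) * f \<in> {f. homogeneous d f}"
    using assms(2) by (simp add: homogeneous_const_mult)
qed

text \<open>For each other point some linear form vanishes there but not at \<open>P i\<close>. The
  product of these forms isolates \<open>P i\<close> in degree \<open>card I - 1\<close>, and a
  power of a linear form nonzero at \<open>P i\<close> fills up the degree to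
  \<open>d\<close>.\<close>

lemma hilbert_fun_large:
  assumes "d \<ge> card I"
  shows "hilbert_fun (P ` I) d = card I"
  unfolding hilbert_fun_eq_card_iff
proof safe
  fix i assume i: "i \<in> I"
  have "\<exists>c. eval_at (a i) (linear_form c) \<noteq> 0 \<and> eval_at (a j) (linear_form c) = 0"
    if j: "j \<in> I - {i}" for j
  proof -
    have Pj: "P j = {c *s a j |c. c \<noteq> 0}" and nz: "a i \<noteq> 0" "a j \<noteq> 0"
      using i j by (intro proj_space_class[OF point coordinates]; simp)+
    have Pi: "P i = {c *s a i |c. c \<noteq> 0}"
      using i by (intro proj_space_class[OF point coordinates])
    have "a i \<noteq> c *s a j" if c: "c \<noteq> 0" for c
    proof
      assume eq: "a i = c *s a j"
      have "P i = P j"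
        unfolding Pi Pj eq by (rule scalar_multiples_eq[OF c])
      then show False
        using distinct i j by (auto dest: inj_onD)
    qed
    then show ?thesis
      using exists_linear_form_separating[OF nz] by metis
  qed
  then obtain c where c: "\<And>j. j \<in> I - {i} \<Longrightarrow> eval_at (a i) (linear_form (c j)) \<noteq> 0"
    "\<And>j. j \<in> I - {i} \<Longrightarrow> eval_at (a j) (linear_form (c j)) = 0"
    by metis
  obtain c0 where c0: "eval_at (a i) (linear_form c0) \<noteq> 0"
    using exists_linear_form_nonzero proj_space_class(1)[OF point coordinates] i by metis
  let ?f = "(\<Prod>j\<in>I - {i}. linear_form (c j)) * linear_form c0 ^ (d - card (I - {i}))"
  show "unit_fun i \<in> value_space d"
  proof (rule unit_fun_in_value_space[OF i])
    have "homogeneous (card (I - {i}) + (d - card (I - {i}))) ?f"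
      by (intro homogeneous_mult homogeneous_prod homogeneous_power homogeneous_linear_form)
    moreover have "card (I - {i}) \<le> d"
      using assms card_Diff1_le[of I i] by linarith
    ultimately show "homogeneous d ?f" by simp
    show "eval_at (a i) ?f \<noteq> 0"
      using c c0 finite_index by (simp add: eval_at_mult eval_at_prod eval_at_power)
    show "eval_at (a j) ?f = 0" if "j \<in> I" "j \<noteq> i" for j
      using c(2)[of j] that finite_index by (auto simp: eval_at_mult eval_at_prod)
  qed
qed

text \<open>Beyond the socle degree all differences vanish, so the value in degree \<open>d\<close>
  agrees with the one in degree \<open>d + card I\<close>, which is already known.\<close>

lemma hilbert_fun_ge_socle_degree:
  assumes "d \<ge> socle_degree (P ` I)"
  shows "hilbert_fun (P ` I) d = card I"
proof -
  \<comment> \<open>A degree above \<open>card I\<close> is positive, and both it and its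
    predecessor lie in the stable range. This bound makes \<open>GREATEST\<close> dominate every
    degree with nonzero difference.\<close>
  have bound: "t \<le> card I" if "hilbert_diff (P ` I) t \<noteq> 0" for t
  proof (rule ccontr)
    assume "\<not> t \<le> card I"
    then have "hilbert_diff (P ` I) t = 0"
      by (simp add: hilbert_diff_def hilbert_fun_large)
    with that show False by simp
  qed
  have "hilbert_diff (P ` I) t = 0" if "t > d" for t
    using Greatest_le_nat[of "\<lambda>t. hilbert_diff (P ` I) t \<noteq> 0" t "card I"] bound that assms
    unfolding socle_degree_def by fastforce
  then have step: "hilbert_fun (P ` I) (Suc t) = hilbert_fun (P ` I) t" if "t \<ge> d" for t
    using that by (force simp: hilbert_diff_def)
  have "hilbert_fun (P ` I) (d + m) = hilbert_fun (P ` I) d" for m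
    by (induction m) (auto simp: step)
  from this[of "card I"] show ?thesis
    by (simp add: hilbert_fun_large)
qed

lemma exists_interpolating_form:
  assumes "d \<ge> socle_degree (P ` I)" "i \<in> I"
  obtains f where "homogeneous d f"
    "\<And>j. j \<in> I \<Longrightarrow> eval_at (a j) f = (if j = i then 1 else 0)"
proof -
  have "unit_fun i \<in> value_space d"
    using hilbert_fun_ge_socle_degree[OF assms(1)] assms(2)
    unfolding hilbert_fun_eq_card_iff by blast
  then obtain f where f: "homogeneous d f" "values f = unit_fun i"
    by (auto simp: value_space_def)
  have "eval_at (a j) f = (if j = i then 1 else 0)" if "j \<in> I" for j
    using fun_cong[OF f(2), of j] that by (simp add: values_def unit_fun_def)
  with f(1) that show thesis by blast
qed

text \<open>In socle degree 0, interpolation would be possible by constants, which cannot separate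
  two points. This later ensures \<open>t \<ge> 1\<close>.\<close>

lemma socle_degree_pos:
  assumes "card I \<ge> 2"
  shows "socle_degree (P ` I) > 0"
proof (rule ccontr)
  assume "\<not> socle_degree (P ` I) > 0"
  obtain i j where ij: "i \<in> I" "j \<in> I" "i \<noteq> j"
    using assms by (metis card_le_Suc0_iff_eq finite_index not_less_eq_eq numeral_2_eq_2)
  obtain f where f: "homogeneous 0 f"
    "\<And>j. j \<in> I \<Longrightarrow> eval_at (a j) f = (if j = i then 1 else 0)"
    using exists_interpolating_form[of 0 i] \<open>\<not> socle_degree (P ` I) > 0\<close> ij(1) by auto
  \<comment> \<open>A form of degree 0 is constant, so all its values agree with the one at the origin.\<close>
  have "eval_at (0 *s a i) f = eval_at (0 *s a j) f"
    by (simp add: vector_smult_lzero)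
  \<comment> \<open>Since \<open>0 ^ 0 = 1\<close>, the scaling rule in degree 0 turns this into
    equality of the values at \<open>a i\<close> and \<open>a j\<close>, which are 1 and 0.\<close>
  with f(2)[of i] f(2)[of j] ij show False
    by (simp add: eval_at_scale_homogeneous[OF f(1)] del: vector_smult_lzero)
qed

end

section \<open>Powers of the linear forms as derivatives of the family\<close>

theorem lemma3p5:
  fixes n r s u :: nat
    and P :: "nat \<Rightarrow> ('k::{alg_closed_field,field_char_0}^'v::finite) set"
    and X :: "('k^'v) set set"
    and a :: "nat \<Rightarrow> 'k^'v"
    and L F :: "nat \<Rightarrow> ('v, 'k) mpoly"
    and \<alpha> :: "nat \<Rightarrow> 'k"
  assumes "n \<ge> 1" and "CARD('v) = n + 1"
    and "X = P ` {1..r}" and "X \<subseteq> proj_space" and "inj_on P {1..r}"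
    and "\<not> (\<exists>H. hyperplane H \<and> X \<subseteq> H)"
    and "s = socle_degree X"
    and "\<And>i. i \<in> {1..r} \<Longrightarrow> a i \<in> P i"
    and "\<And>i. i \<in> {1..r} \<Longrightarrow> L i = linear_form (a i)"
    and "u \<ge> 1"
    and "\<And>i. i \<in> {1..r} \<Longrightarrow> \<alpha> i \<noteq> 0"
    and "\<And>j. j \<ge> 1 \<Longrightarrow>
           F j = const (1 / fact (j + u)) * (\<Sum>i=1..r. const (\<alpha> i) * L i ^ (j + u))"
  shows "\<forall>w\<ge>1. \<forall>i\<in>{1..r}. \<forall>t. int t \<ge> max (int s) (int s + int w - int u) \<longrightarrow>
           (\<exists>\<beta> :: ('v, 'k) mpoly. homogeneous (t + u - w) \<beta> \<and> L i ^ w = diff_action \<beta> (F t))"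
proof (intro allI impI ballI)
  fix w i t
  assume i: "i \<in> {1..r}" and t: "int t \<ge> max (int s) (int s + int w - int u)"
  interpret projective_points "{1..r}" P a
    using assms(3-5,8) by unfold_locales auto
  \<comment> \<open>The index \<open>i\<close> shows that there is a point, and a single point would
    lie in a hyperplane because there are at least two coordinates.\<close>
  have "r \<ge> 2"
  proof (rule ccontr)
    assume "\<not> r \<ge> 2"
    with i have "r = 1" "i = 1" by auto
    then have "X = {P i}" "P i \<in> proj_space"
      using point[OF i] by (simp_all add: assms(3))
    with assms(1,2,6) show False
      using point_in_hyperplane[of "P i"] by auto
  qed
  then have "s > 0"
    using socle_degree_pos by (simp add: assms(3,7))
  \<comment> \<open>The first bound gives access to the formula for \<open>F t\<close>; the others
    put the degree in the interpolation range and make the natural subtraction exact.\<close>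
  with t have t1: "t \<ge> 1" and le: "s \<le> t + u - w" "w \<le> t + u"
    by auto
  then obtain f where f: "homogeneous (t + u - w) f"
    "\<And>j. j \<in> {1..r} \<Longrightarrow> eval_at (a j) f = (if j = i then 1 else 0)"
    using exists_interpolating_form[OF _ i, of "t + u - w"] by (auto simp: assms(3,7))
  \<comment> \<open>The action on \<open>L i ^ (t + u)\<close> yields
    \<open>fact (t + u) / fact w\<close> times the value of \<beta> at \<open>a i\<close>, and the
    coefficient of this power in \<open>F t\<close> is \<open>\<alpha> i / fact (t + u)\<close>. The
    constant cancels both.\<close>
  define \<beta> where "\<beta> = const (fact w / \<alpha> i) * f"
  have \<beta>: "homogeneous (t + u - w) \<beta>"
    unfolding \<beta>_def using f(1) by (rule homogeneous_const_mult)
  \<comment> \<open>Since \<open>f\<close> vanishes at the other points, the powers of all other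
    linear forms are annihilated.\<close>
  have act: "diff_action \<beta> (L j ^ (t + u)) =
      (if j = i then const (fact (t + u) / \<alpha> i) * L i ^ w else 0)" if j: "j \<in> {1..r}" for j
  proof -
    have "t + u - (t + u - w) = w" using le by simp
    then show ?thesis
      using diff_action_power_linear_form[OF \<beta>, of "t + u" "a j"] assms(9)[OF j] f(2)[OF j]
      by (auto simp: \<beta>_def eval_at_mult)
  qed
  have "diff_action \<beta> (F t) = const (1 / fact (t + u)) *
      (\<Sum>j=1..r. const (\<alpha> j) * diff_action \<beta> (L j ^ (t + u)))"
    by (simp add: assms(12)[OF t1] diff_action_const_mult diff_action_sum)
  also have "(\<Sum>j=1..r. const (\<alpha> j) * diff_action \<beta> (L j ^ (t + u))) =
      (\<Sum>j=1..r. if j = i then const (fact (t + u)) * L i ^ w else 0)"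
    using assms(11)[OF i]
    by (intro sum.cong) (auto simp: act mult.assoc[symmetric] const_mult[symmetric])
  also have "\<dots> = const (fact (t + u)) * L i ^ w"
    using i by simp
  also have "const (1 / fact (t + u)) * (const (fact (t + u)) * L i ^ w) = L i ^ w"
    by (simp add: mult.assoc[symmetric] const_mult[symmetric])
  finally show "\<exists>\<beta>. homogeneous (t + u - w) \<beta> \<and> L i ^ w = diff_action \<beta> (F t)"
    using \<beta> by metis
qed

end
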